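(* Fix $\epsilon > 0$. There exists $n_0 = n_0(\epsilon)$ such that for every integer $n \ge n_0$ and every $f(x) \in \mathbb{F}_2[x]$ with $\deg f = n$, there exists a squarefree polynomial $g(x) \in \mathbb{F}_2[x]$ of degree $n$ such that \[ L_2(f-g) \le (\ln n)^{2\ln(2)+\epsilon}. \]
   Context: For $h \in \mathbb{F}_2[x]$, the length $L_2(h)$ is obtained by representing each coefficient of $h$ by an integer in $(-1, 1]$ (i.e. by $0$ or $1$) and summing the absolute values; equivalently, $L_2(h)$ is the number of nonzero coefficients of $h$. A polynomial in $\mathbb{F}_2[x]$ is squarefree if it is not divisible by the square of a non-constant irreducible polynomial. *)

theory Defs
  imports
    Complex_Main
    "HOL-Library.Z2"
    "HOL-Computational_Algebra.Polynomial"
    "HOL-Computational_Algebra.Squarefree"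
begin

text \<open>
  The ring of polynomials over the field with two elements is \<^typ>\<open>bit poly\<close>;
  \<open>of_int :: int \<Rightarrow> bit\<close> is reduction modulo 2.
\<close>

definition int_rep :: "bit \<Rightarrow> int" where
  "int_rep a = (THE k. (-1 < k \<and> k \<le> 1) \<and> of_int k = a)"

definition L2 :: "bit poly \<Rightarrow> int" where
  "L2 h = (\<Sum>i\<le>degree h. \<bar>int_rep (coeff h i)\<bar>)"

lemma int_rep_simps [simp]: "int_rep 0 = 0" "int_rep 1 = 1"
proof -
  have *: "-1 < k \<and> k \<le> 1 \<longleftrightarrow> k = 0 \<or> k = 1" for k :: int
    by auto
  show "int_rep 0 = 0"
    unfolding int_rep_def * by (rule the_equality) fastforce+
  show "int_rep 1 = 1"
    unfolding int_rep_def * by (rule the_equality) fastforce+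
qed

lemma L2_eq_card: "L2 h = int (card {i. coeff h i \<noteq> 0})"
proof -
  have sub: "{i. coeff h i \<noteq> 0} \<subseteq> {..degree h}"
    by (auto simp del: bit_not_zero_iff intro: le_degree)
  have "L2 h = (\<Sum>i\<le>degree h. if coeff h i \<noteq> 0 then 1 else 0)"
    unfolding L2_def
  proof (rule sum.cong)
    fix i
    show "\<bar>int_rep (coeff h i)\<bar> = (if coeff h i \<noteq> 0 then 1 else 0)"
      by (cases "coeff h i") auto
  qed simp
  also have "\<dots> = (\<Sum>i | coeff h i \<noteq> 0. 1)"
    using sub by (intro sum.mono_neutral_cong_right) auto
  finally show ?thesis by simp
qed

lemma irreducible_factor_exists:
  fixes p :: "'a :: field poly"
  assumes "degree p > 0"
  shows "\<exists>q. irreducible q \<and> degree q > 0 \<and> q dvd p"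
  using assms
proof (induction "degree p" arbitrary: p rule: less_induct)
  case less
  show ?case
  proof (cases "irreducible p")
    case True
    with less.prems show ?thesis by (intro exI[of _ p]) auto
  next
    case False
    from less.prems have p_nz: "p \<noteq> 0" by auto
    with less.prems have p0: "p \<noteq> 0" "\<not> p dvd 1"
      by (simp_all add: is_unit_iff_degree)
    with False obtain a b where ab: "p = a * b" "\<not> a dvd 1" "\<not> b dvd 1"
      by (auto simp: irreducible_def)
    with p0 have nz: "a \<noteq> 0" "b \<noteq> 0" by auto
    with ab have "degree a > 0" "degree b > 0"
      by (auto simp: is_unit_iff_degree)
    moreover from this have "degree a < degree p"
      using ab nz by (simp add: degree_mult_eq)
    ultimately obtain q where "irreducible q" "degree q > 0" "q dvd a"
      using less.hyps[of a] by blast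
    with ab show ?thesis by auto
  qed
qed

text \<open>
  The library's \<^const>\<open>squarefree\<close> (no non-unit square divides) agrees with
  non-divisibility by squares of non-constant irreducible polynomials.
\<close>

lemma squarefree_poly_iff:
  fixes p :: "'a :: field poly"
  shows "squarefree p \<longleftrightarrow> \<not> (\<exists>q. irreducible q \<and> degree q > 0 \<and> q\<^sup>2 dvd p)"
proof
  assume sf: "squarefree p"
  show "\<not> (\<exists>q. irreducible q \<and> degree q > 0 \<and> q\<^sup>2 dvd p)"
  proof
    assume "\<exists>q. irreducible q \<and> degree q > 0 \<and> q\<^sup>2 dvd p"
    then obtain q where "irreducible q" "q\<^sup>2 dvd p" by blast
    with sf show False
      by (auto dest: squarefreeD simp: irreducible_def)
  qed
next
  assume *: "\<not> (\<exists>q. irreducible q \<and> degree q > 0 \<and> q\<^sup>2 dvd p)"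
  show "squarefree p"
  proof (rule squarefreeI, rule ccontr)
    fix x assume x: "x\<^sup>2 dvd p" "\<not> x dvd 1"
    obtain y where y: "degree y > 0" "y\<^sup>2 dvd p"
    proof (cases "x = 0")
      case True
      with x have "([:0, 1:] :: 'a poly)\<^sup>2 dvd p" by simp
      moreover have "degree ([:0, 1:] :: 'a poly) > 0" by simp
      ultimately show ?thesis using that by blast
    next
      case False
      with x have "degree x > 0" by (auto simp: is_unit_iff_degree)
      with x that show ?thesis by blast
    qed
    from irreducible_factor_exists[OF y(1)]
    obtain q where q: "irreducible q" "degree q > 0" "q dvd y" by blast
    then have "q\<^sup>2 dvd p" using y(2) by (meson dvd_power_same dvd_trans)
    with q * show False by blast
  qed
qed

end

theory Submission
  imports
    Defs
    "HOL-Computational_Algebra.Polynomial_Factorial"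
    "HOL-Analysis.Harmonic_Numbers"
    "HOL-Real_Asymp.Real_Asymp"
begin

text \<open>
  Every \<open>f\<close> over \<open>F\<^sub>2\<close> is uniquely \<open>a\<^sup>2 + x b\<^sup>2\<close>, and its derivative is \<open>b\<^sup>2\<close>; hence
  \<open>f\<close> is squarefree as soon as \<open>a\<close> and \<open>b\<close> have no common irreducible factor. Changing
  \<open>a\<close> and \<open>b\<close> by polynomials \<open>u\<close> and \<open>v\<close> of degree below \<open>d\<close> changes at most \<open>2 d\<close>
  coefficients of \<open>f\<close>. An irreducible \<open>p\<close> of degree \<open>j \<le> d\<close> divides both \<open>a + u\<close> and
  \<open>b + v\<close> for at most a fraction \<open>4\<^sup>-\<^sup>j\<close> of the pairs \<open>(u, v)\<close>. As \<open>p = x\<close> or \<open>p\<close> has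
  constant term 1, these fractions add up to less than \<open>1/4 + 1/2\<close>. The irreducible factors
  of degree above \<open>d\<close> spoil at most \<open>deg a\<close> choices of \<open>v\<close> for each \<open>u\<close>. A good pair
  therefore remains once \<open>2\<^sup>d \<ge> 4 deg a\<close>, so \<open>d\<close> can be logarithmic in \<open>deg f\<close>, and the
  exponent \<open>2 ln 2\<close> exceeds 1.
\<close>

section \<open>Counting polynomials over the field with two elements\<close>

definition polys_below :: "nat \<Rightarrow> 'a :: zero poly set" where
  "polys_below d = {u. \<forall>i\<ge>d. coeff u i = 0}"

lemma polys_below_0: "polys_below 0 = {0}"
  by (auto simp: polys_below_def poly_eq_iff)

lemma polys_below_Suc:
  "(polys_below (Suc d) :: bit poly set) = pCons 0 ` polys_below d \<union> pCons 1 ` polys_below d"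
proof -
  have *: "pCons c q \<in> polys_below (Suc d) \<longleftrightarrow> q \<in> polys_below d" for c and q :: "bit poly"
    by (auto simp: polys_below_def coeff_pCons Suc_le_eq split: nat.splits)
  have "p \<in> polys_below (Suc d) \<longleftrightarrow> p \<in> pCons 0 ` polys_below d \<union> pCons 1 ` polys_below d"
    for p :: "bit poly"
  proof (cases p rule: pCons_cases)
    case (pCons c q)
    then show ?thesis by (cases c) (auto simp: *)
  qed
  then show ?thesis by blast
qed

lemma finite_polys_below [simp]: "finite (polys_below d :: bit poly set)"
  by (induction d) (auto simp: polys_below_0 polys_below_Suc)

lemma card_polys_below: "card (polys_below d :: bit poly set) = 2 ^ d"
proof (induction d)
  case (Suc d)
  have "inj_on (pCons c) (polys_below d)" for c :: bit
    by (auto intro: inj_onI)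
  moreover have "pCons 0 ` polys_below d \<inter> pCons 1 ` (polys_below d :: bit poly set) = {}"
    by auto
  ultimately show ?case
    using Suc by (simp add: polys_below_Suc card_Un_disjoint card_image)
qed (simp add: polys_below_0)

lemma polys_below_diff:
  fixes u v :: "'a :: ab_group_add poly"
  shows "u \<in> polys_below d \<Longrightarrow> v \<in> polys_below d \<Longrightarrow> u - v \<in> polys_below d"
  by (auto simp: polys_below_def)

text \<open>Zero is listed apart because its degree is 0, so \<open>degree u < d\<close> misses it
  when \<open>d = 0\<close>.\<close>

lemma mem_polys_below_iff: "u \<in> polys_below d \<longleftrightarrow> u = 0 \<or> degree u < d"
proof (cases "u = 0")
  case False
  then have "degree u < d" if "\<forall>i\<ge>d. coeff u i = 0"
    using that leading_coeff_0_iff not_le by blast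
  then show ?thesis using False by (auto simp: polys_below_def coeff_eq_0)
qed (simp add: polys_below_def)

text \<open>Two such \<open>u\<close> differ by some \<open>p * q\<close> in
  \<open>polys_below d\<close>, so all of them arise from one by varying \<open>q\<close> in
  \<open>polys_below (d - degree p)\<close>. Truncated subtraction is intended: for
  \<open>degree p \<ge> d\<close> the bound is 1.\<close>

lemma card_shifted_multiples_le:
  fixes a p :: "bit poly"
  assumes "p \<noteq> 0"
  shows "card {u \<in> polys_below d. p dvd a + u} \<le> 2 ^ (d - degree p)"
proof (cases "{u \<in> polys_below d. p dvd a + u} = {}")
  case True
  show ?thesis unfolding True by simp
next
  case False
  then obtain u0 where u0: "u0 \<in> polys_below d" "p dvd a + u0" by auto
  have "{u \<in> polys_below d. p dvd a + u} \<subseteq> (\<lambda>q. u0 + p * q) ` polys_below (d - degree p)"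
  proof
    fix u assume "u \<in> {u \<in> polys_below d. p dvd a + u}"
    then have u: "u \<in> polys_below d" "p dvd a + u" by auto
    have "p dvd (a + u) - (a + u0)" using u u0 by (intro dvd_diff)
    then obtain q where q: "u - u0 = p * q" by (auto simp: dvd_def)
    have "p * q \<in> polys_below d" using u u0 polys_below_diff q by metis
    then have "q \<in> polys_below (d - degree p)"
      using assms by (cases "q = 0") (auto simp: mem_polys_below_iff degree_mult_eq)
    moreover have "u = u0 + p * q" using q by (metis add.commute diff_add_cancel)
    ultimately show "u \<in> (\<lambda>q. u0 + p * q) ` polys_below (d - degree p)" by blast
  qed
  then have "card {u \<in> polys_below d. p dvd a + u} \<le> card (polys_below (d - degree p) :: bit poly set)"
    by (rule surj_card_le[OF finite_polys_below])
  then show ?thesis by (simp add: card_polys_below)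
qed

text \<open>The leading and the constant coefficient are both 1, which leaves \<open>j\<close> free
  coefficients in between.\<close>

lemma polys_degree_coeff_0_finite_card:
  "finite {p :: bit poly. degree p = Suc j \<and> coeff p 0 = 1}"
  "card {p :: bit poly. degree p = Suc j \<and> coeff p 0 = 1} \<le> 2 ^ j"
proof -
  let ?g = "\<lambda>u :: bit poly. pCons 1 (u + monom 1 j)"
  have sub: "{p :: bit poly. degree p = Suc j \<and> coeff p 0 = 1} \<subseteq> ?g ` polys_below j"
  proof
    fix p :: "bit poly" assume p: "p \<in> {p. degree p = Suc j \<and> coeff p 0 = 1}"
    obtain q where q: "p = pCons 1 q" using p by (cases p rule: pCons_cases) auto
    with p have dq: "degree q = j" by (auto split: if_splits)
    have "q \<noteq> 0" using p q by auto
    then have "coeff q j = 1" using dq leading_coeff_0_iff[of q] by (cases "coeff q j") auto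
    then have "q - monom 1 j \<in> polys_below j"
      using dq by (auto simp: polys_below_def coeff_eq_0)
    moreover have "p = ?g (q - monom 1 j)" using q by simp
    ultimately show "p \<in> ?g ` polys_below j" by blast
  qed
  show "finite {p :: bit poly. degree p = Suc j \<and> coeff p 0 = 1}"
    by (rule finite_subset[OF sub]) simp
  show "card {p :: bit poly. degree p = Suc j \<and> coeff p 0 = 1} \<le> 2 ^ j"
    using surj_card_le[OF finite_polys_below sub] by (simp add: card_polys_below)
qed

section \<open>Irreducible divisors\<close>

lemma bit_poly_dvd_antisym:
  fixes p q :: "bit poly"
  assumes "p dvd q" "q dvd p"
  shows "p = q"
proof (cases "p = 0")
  case False
  obtain k where k: "q = p * k" using assms by auto
  have "k \<noteq> 0" using k assms False by auto
  have "q \<noteq> 0" using k \<open>k \<noteq> 0\<close> False by auto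
  then have "degree q \<le> degree p" using assms False by (simp add: dvd_imp_degree_le)
  then have "degree k = 0" using k False \<open>k \<noteq> 0\<close> by (simp add: degree_mult_eq)
  then obtain c where "k = [:c:]" by (metis degree_eq_zeroE)
  with \<open>k \<noteq> 0\<close> have "k = 1" by (cases c) auto
  with k show ?thesis by simp
qed (use assms in auto)

lemma irreducible_bit_poly_dvd_eq:
  fixes p q :: "bit poly"
  assumes "irreducible p" "irreducible q" "p dvd q"
  shows "p = q"
proof -
  obtain k where k: "q = p * k" using assms(3) by auto
  have "\<not> p dvd 1" using assms(1) by (auto simp: irreducible_def)
  with assms(2) k have "k dvd 1" by (auto simp: irreducible_def)
  then have "k = 1" by (intro bit_poly_dvd_antisym) auto
  with k show ?thesis by simp
qed

lemma degree_irreducible_pos: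
  fixes p :: "'a :: field poly"
  assumes "irreducible p"
  shows "degree p > 0"
  using assms by (auto simp: irreducible_def is_unit_iff_degree)

text \<open>Removing one irreducible factor \<open>p\<close> lowers the degree by at least 1 and
  loses at most the divisor \<open>p\<close>, since irreducibles are prime.\<close>

lemma irreducible_divisors_finite_card:
  fixes h :: "bit poly"
  assumes "h \<noteq> 0"
  shows "finite {p. irreducible p \<and> p dvd h} \<and> card {p. irreducible p \<and> p dvd h} \<le> degree h"
  using assms
proof (induction "degree h" arbitrary: h rule: less_induct)
  case less
  show ?case
  proof (cases "{p. irreducible p \<and> p dvd h} = {}")
    case True
    show ?thesis unfolding True by simp
  next
    case False
    then obtain p k where p: "irreducible p" "h = p * k" unfolding dvd_def by blast
    have nz: "p \<noteq> 0" "k \<noteq> 0" using p less.prems by auto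
    have deg: "degree h = degree p + degree k" using p nz by (simp add: degree_mult_eq)
    have pos: "degree p > 0" using p degree_irreducible_pos by blast
    have IH: "finite {p. irreducible p \<and> p dvd k}" "card {p. irreducible p \<and> p dvd k} \<le> degree k"
      using less.hyps[of k] nz deg pos by auto
    have sub: "{q. irreducible q \<and> q dvd h} \<subseteq> insert p {q. irreducible q \<and> q dvd k}"
    proof
      fix q assume "q \<in> {q. irreducible q \<and> q dvd h}"
      then have q: "irreducible q" "q dvd p * k" using p by auto
      then have "q dvd p \<or> q dvd k"
        using field_poly_irreducible_imp_prime prime_elem_dvd_mult_iff by blast
      then show "q \<in> insert p {q. irreducible q \<and> q dvd k}"
        using q p irreducible_bit_poly_dvd_eq by blast
    qed
    have "card {q. irreducible q \<and> q dvd h} \<le> card (insert p {q. irreducible q \<and> q dvd k})"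
      using IH by (intro card_mono sub) simp
    also have "\<dots> \<le> Suc (card {q. irreducible q \<and> q dvd k})"
      using IH by (simp add: card_insert_if)
    finally have "card {q. irreducible q \<and> q dvd h} \<le> Suc (card {q. irreducible q \<and> q dvd k})" .
    then show ?thesis using finite_subset[OF sub] IH deg pos by auto
  qed
qed

text \<open>This halves the candidates of each degree. With all \<open>2^j\<close> polynomials of
  degree \<open>j\<close>, the fractions \<open>4^-j\<close> would add up to almost 1 and leave no
  room for the large factors.\<close>

lemma irreducible_bit_poly_cases:
  fixes p :: "bit poly"
  assumes "irreducible p"
  shows "p = [:0, 1:] \<or> coeff p 0 = 1"
proof (cases "coeff p 0 = 1")
  case False
  then have "coeff p 0 = 0" by (cases "coeff p 0") auto
  then have "[:0, 1:] dvd p" using poly_eq_0_iff_dvd[of p 0] by (simp add: poly_0_coeff_0)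
  moreover have "irreducible ([:0, 1:] :: bit poly)" by (intro irreducible_linear_field_poly) simp
  ultimately show ?thesis using assms irreducible_bit_poly_dvd_eq by blast
qed simp

section \<open>Making two polynomials coprime by small shifts\<close>

text \<open>A geometric sum: divided by \<open>4^d\<close>, it equals \<open>(1 - 2^-d) / 2\<close>.
  The surplus \<open>2^d\<close> later provides the strict inequality.\<close>

lemma sum_two_four: "2 * (\<Sum>j<d. 2 ^ j * 4 ^ (d - Suc j)) + 2 ^ d = (4 :: nat) ^ d"
proof (induction d)
  case (Suc d)
  have "(\<Sum>j<d. 2 ^ j * 4 ^ (d - j)) = 4 * (\<Sum>j<d. 2 ^ j * (4 :: nat) ^ (d - Suc j))"
    unfolding sum_distrib_left by (intro sum.cong) (auto simp: Suc_diff_Suc simp flip: power_Suc)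
  with Suc show ?case by simp
qed simp

lemma coprime_shift_exists:
  fixes a b :: "bit poly"
  assumes d: "0 < d" "d \<le> degree a" "4 * degree a \<le> 2 ^ d"
  shows "\<exists>u\<in>polys_below d. \<exists>v\<in>polys_below d.
           \<not> (\<exists>p. irreducible p \<and> p dvd a + u \<and> p dvd b + v)"
proof (rule ccontr)
  assume neg: "\<not> ?thesis"
  \<comment> \<open>\<open>B p\<close> holds the pairs spoiled by \<open>p\<close>.
    \<open>Q j\<close> contains every irreducible of degree \<open>j + 1\<close> except possibly
    \<open>x\<close>. \<open>R u\<close> holds the large irreducible factors of
    \<open>a + u\<close>, and \<open>V p\<close> the \<open>v\<close> that \<open>p\<close> then
    spoils.\<close>
  define B where "B p = {u \<in> polys_below d. p dvd a + u} \<times> {v \<in> polys_below d. p dvd b + v}" for p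
  define Q where "Q j = {p :: bit poly. degree p = Suc j \<and> coeff p 0 = 1}" for j
  define R where "R u = {p. irreducible p \<and> p dvd a + u \<and> d < degree p}" for u
  define V where "V p = {v \<in> polys_below d. p dvd b + v}" for p
  let ?U = "polys_below d :: bit poly set"
  have cardB: "card (B p) \<le> 4 ^ (d - degree p)" if "p \<noteq> 0" for p
  proof -
    have "card (B p) \<le> 2 ^ (d - degree p) * 2 ^ (d - degree p)"
      unfolding B_def card_cartesian_product
      by (intro mult_mono card_shifted_multiples_le that) auto
    then show ?thesis by (simp flip: power_mult_distrib)
  qed
  have finB: "finite (B p)" for p by (simp add: B_def)
  have finV: "finite (V p)" for p by (simp add: V_def)
  \<comment> \<open>As \<open>d \<le> degree a\<close>, the shift cannot reach the leading
    coefficient, so \<open>a + u\<close> has at most \<open>degree a\<close> irreducible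
    divisors.\<close>
  have degu: "a + u \<noteq> 0 \<and> degree (a + u) = degree a" if u: "u \<in> ?U" for u
  proof (cases "u = 0")
    case True
    have "a \<noteq> 0" using d by auto
    with True show ?thesis by simp
  next
    case False
    then have "degree u < degree a" using u d by (auto simp: mem_polys_below_iff)
    then show ?thesis by (metis add.commute add_eq_0_iff degree_add_eq_left degree_minus less_irrefl)
  qed
  have R: "finite (R u)" "card (R u) \<le> degree a" if u: "u \<in> ?U" for u
  proof -
    have sub: "R u \<subseteq> {p. irreducible p \<and> p dvd a + u}" by (auto simp: R_def)
    note * = irreducible_divisors_finite_card[of "a + u"] degu[OF u]
    show "finite (R u)" using sub * finite_subset by blast
    show "card (R u) \<le> degree a" using card_mono[OF _ sub] * by fastforce
  qed
  \<comment> \<open>Small irreducibles are summed over independently of the pair. Large ones are too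
    many for that, so they are taken from the divisors of \<open>a + u\<close>, separately for each
    \<open>u\<close>.\<close>
  have "?U \<times> ?U \<subseteq> B [:0, 1:] \<union> (\<Union>j<d. \<Union>p\<in>Q j. B p) \<union> (SIGMA u:?U. \<Union>p\<in>R u. V p)"
  proof
    fix w assume "w \<in> ?U \<times> ?U"
    then obtain u v where w: "w = (u, v)" "u \<in> ?U" "v \<in> ?U" by auto
    with neg obtain p where p: "irreducible p" "p dvd a + u" "p dvd b + v" by blast
    have "degree p > 0" using p degree_irreducible_pos by blast
    then obtain j where j: "degree p = Suc j" by (cases "degree p") auto
    have wB: "w \<in> B p" using w p by (auto simp: B_def)
    consider "p = [:0, 1:]" | "d < degree p" | "degree p \<le> d" "coeff p 0 = 1"
      using irreducible_bit_poly_cases[OF p(1)] by linarith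
    then show "w \<in> B [:0, 1:] \<union> (\<Union>j<d. \<Union>p\<in>Q j. B p) \<union> (SIGMA u:?U. \<Union>p\<in>R u. V p)"
    proof cases
      case 1 then show ?thesis using wB by simp
    next
      case 2 then show ?thesis using w p by (auto simp: R_def V_def)
    next
      case 3
      then have "p \<in> Q j" "j < d" using j by (auto simp: Q_def)
      then show ?thesis using wB by blast
    qed
  qed
  then have "card (?U \<times> ?U) \<le> card (B [:0, 1:] \<union> (\<Union>j<d. \<Union>p\<in>Q j. B p) \<union> (SIGMA u:?U. \<Union>p\<in>R u. V p))"
    using polys_degree_coeff_0_finite_card(1) R(1) finB finV
    by (intro card_mono) (auto simp: Q_def)
  also have "\<dots> \<le> card (B [:0, 1:]) + card (\<Union>j<d. \<Union>p\<in>Q j. B p) + card (SIGMA u:?U. \<Union>p\<in>R u. V p)"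
    by (meson card_Un_le add_mono le_refl le_trans)
  finally have total: "4 ^ d \<le> card (B [:0, 1:]) + card (\<Union>j<d. \<Union>p\<in>Q j. B p) + card (SIGMA u:?U. \<Union>p\<in>R u. V p)"
    by (simp add: card_cartesian_product card_polys_below flip: power_mult_distrib)
  have "card (\<Union>j<d. \<Union>p\<in>Q j. B p) \<le> (\<Sum>j<d. card (\<Union>p\<in>Q j. B p))"
    by (intro card_UN_le) auto
  also have "\<dots> \<le> (\<Sum>j<d. 2 ^ j * 4 ^ (d - Suc j))"
  proof (intro sum_mono)
    fix j
    have "card (\<Union>p\<in>Q j. B p) \<le> (\<Sum>p\<in>Q j. card (B p))"
      using polys_degree_coeff_0_finite_card(1) by (intro card_UN_le) (auto simp: Q_def)
    also have "\<dots> \<le> (\<Sum>p\<in>Q j. 4 ^ (d - Suc j))"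
    proof (intro sum_mono)
      fix p assume "p \<in> Q j"
      then have "p \<noteq> 0" "degree p = Suc j" by (auto simp: Q_def)
      then show "card (B p) \<le> 4 ^ (d - Suc j)" using cardB[of p] by simp
    qed
    also have "\<dots> \<le> 2 ^ j * 4 ^ (d - Suc j)"
      using polys_degree_coeff_0_finite_card(2) by (simp add: Q_def)
    finally show "card (\<Union>p\<in>Q j. B p) \<le> 2 ^ j * 4 ^ (d - Suc j)" .
  qed
  finally have small: "2 * card (\<Union>j<d. \<Union>p\<in>Q j. B p) + 2 ^ d \<le> 4 ^ d"
    using sum_two_four[of d] by linarith
  have "card (SIGMA u:?U. \<Union>p\<in>R u. V p) = (\<Sum>u\<in>?U. card (\<Union>p\<in>R u. V p))"
    using R finV by (subst card_SigmaI) auto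
  also have "\<dots> \<le> (\<Sum>u\<in>?U. degree a)"
  proof (intro sum_mono)
    fix u assume u: "u \<in> ?U"
    have "card (\<Union>p\<in>R u. V p) \<le> (\<Sum>p\<in>R u. card (V p))"
      using R u by (intro card_UN_le) auto
    \<comment> \<open>A factor of degree above \<open>d\<close> divides \<open>b + v\<close> for at
      most one \<open>v\<close>.\<close>
    also have "\<dots> \<le> (\<Sum>p\<in>R u. 1)"
    proof (intro sum_mono)
      fix p assume "p \<in> R u"
      then have "p \<noteq> 0" "d - degree p = 0" by (auto simp: R_def)
      then show "card (V p) \<le> 1" using card_shifted_multiples_le[of p d b] by (simp add: V_def)
    qed
    also have "\<dots> \<le> degree a" using R u by simp
    finally show "card (\<Union>p\<in>R u. V p) \<le> degree a" .
  qed
  finally have "4 * card (SIGMA u:?U. \<Union>p\<in>R u. V p) \<le> 2 ^ d * (4 * degree a)"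
    by (simp add: card_polys_below)
  also have "\<dots> \<le> 2 ^ d * 2 ^ d" using d by (intro mult_left_mono) auto
  also have "\<dots> = (4 :: nat) ^ d" by (simp flip: power_mult_distrib)
  finally have large: "4 * card (SIGMA u:?U. \<Union>p\<in>R u. V p) \<le> 4 ^ d" .
  have "4 * card (B [:0, 1:]) \<le> 4 ^ d"
    using cardB[of "[:0, 1:]"] d by (cases d) auto
  \<comment> \<open>The three parts cover at most the fractions 1/4, \<open>(1 - 2^-d) / 2\<close>
    and 1/4 of all \<open>4^d\<close> pairs, which is less than 1 in total.\<close>
  with total small large show False using zero_less_power[of "2::nat" d] by linarith
qed


section \<open>Squares in characteristic 2 and the splitting into \<open>a^2 + x b^2\<close>\<close>

lemma bit_add_self [simp]: "x + x = 0" for x :: bit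
  by (cases x) auto

lemma bit_poly_add_self: "p + p = 0" for p :: "bit poly"
  by (rule poly_eqI) (simp only: coeff_add bit_add_self coeff_0)

lemma bit_poly_power2_add: "(p + q)\<^sup>2 = p\<^sup>2 + q\<^sup>2" for p q :: "bit poly"
proof -
  have "(p + q)\<^sup>2 = p\<^sup>2 + q\<^sup>2 + (p * q + p * q)" by (simp add: power2_eq_square algebra_simps)
  then show ?thesis by (simp only: bit_poly_add_self add_0_right)
qed

lemma bit_poly_power2_pCons: "(pCons c p)\<^sup>2 = pCons c (pCons 0 (p\<^sup>2))" for p :: "bit poly"
proof -
  have "pCons c p = [:c:] + pCons 0 p" by simp
  then have "(pCons c p)\<^sup>2 = [:c:]\<^sup>2 + (pCons 0 p)\<^sup>2" by (simp only: bit_poly_power2_add)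
  then show ?thesis by (cases c) (simp_all add: power2_eq_square)
qed

text \<open>Cross terms vanish and \<open>c^2 = c\<close> for coefficients, so \<open>p^2\<close> is
  \<open>p\<close> evaluated at \<open>x^2\<close>.\<close>

lemma coeff_bit_poly_power2:
  "coeff (p\<^sup>2) k = (if even k then coeff p (k div 2) else 0)" for p :: "bit poly"
proof (induction p arbitrary: k)
  case (pCons c p)
  show ?case
  proof (cases k)
    case (Suc m)
    then show ?thesis using pCons.IH
      by (cases m) (auto simp: bit_poly_power2_pCons coeff_pCons)
  qed (simp add: bit_poly_power2_pCons)
qed simp

text \<open>Since squaring spreads coefficients to even positions, this interleaves the coefficients
  of \<open>a\<close> and \<open>b\<close>.\<close>

definition merge :: "bit poly \<Rightarrow> bit poly \<Rightarrow> bit poly" where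
  "merge a b = a\<^sup>2 + pCons 0 (b\<^sup>2)"

lemma coeff_merge: "coeff (merge a b) k = (if even k then coeff a (k div 2) else coeff b (k div 2))"
  by (cases k) (auto simp: merge_def coeff_bit_poly_power2)

lemma merge_add: "merge (a + u) (b + v) = merge a b + merge u v"
  by (simp add: poly_eq_iff coeff_merge)

text \<open>Multiplying by \<open>x\<close> swaps the roles:
  \<open>c + x (a^2 + x b^2) = (c + x b)^2 + x a^2\<close>.\<close>

lemma merge_surj: "\<exists>a b. f = merge a b"
proof (induction f)
  case 0
  have "0 = merge 0 0" by (simp add: merge_def)
  then show ?case by blast
next
  case (pCons c f)
  then obtain a b where "f = merge a b" by blast
  then have "pCons c f = merge (pCons c b) a"
    by (simp add: merge_def bit_poly_power2_pCons)
  then show ?case by blast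
qed

lemma pderiv_bit_poly_power2: "pderiv (p\<^sup>2) = 0" for p :: "bit poly"
  by (simp only: power2_eq_square pderiv_mult bit_poly_add_self)

lemma pderiv_merge: "pderiv (merge a b) = b\<^sup>2"
  by (simp add: merge_def pderiv_add pderiv_pCons pderiv_bit_poly_power2)

text \<open>If \<open>q^2\<close> divides the polynomial, it also divides the derivative
  \<open>b^2\<close>, because \<open>q^2\<close> has derivative 0. So \<open>q\<close> divides
  \<open>b\<close>, hence \<open>a^2\<close>, hence \<open>a\<close>.\<close>

lemma squarefree_merge:
  assumes "\<not> (\<exists>p. irreducible p \<and> p dvd a \<and> p dvd b)"
  shows "squarefree (merge a b)"
  unfolding squarefree_poly_iff
proof
  assume "\<exists>q. irreducible q \<and> degree q > 0 \<and> q\<^sup>2 dvd merge a b"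
  then obtain q r where q: "irreducible q" "merge a b = q\<^sup>2 * r"
    unfolding dvd_def by blast
  have prime: "prime_elem q" using q field_poly_irreducible_imp_prime by blast
  have "pderiv (merge a b) = q\<^sup>2 * pderiv r"
    by (simp add: q pderiv_mult pderiv_bit_poly_power2)
  then have "q dvd b\<^sup>2" by (simp add: pderiv_merge power2_eq_square mult.assoc)
  then have "q dvd b" using prime prime_elem_dvd_power by blast
  then have "q dvd [:0, 1:] * b\<^sup>2" by (intro dvd_mult) (simp add: power2_eq_square)
  moreover have "q dvd a\<^sup>2 + [:0, 1:] * b\<^sup>2"
    using q(2) by (simp add: merge_def power2_eq_square mult.assoc)
  ultimately have "q dvd a\<^sup>2" using dvd_add_left_iff by blast
  then have "q dvd a" using prime prime_elem_dvd_power by blast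
  with \<open>q dvd b\<close> q assms show False by blast
qed

section \<open>The nearby squarefree polynomial and the logarithmic bound\<close>

lemma L2_le:
  assumes "\<And>i. i \<ge> k \<Longrightarrow> coeff h i = 0"
  shows "L2 h \<le> int k"
proof -
  have "{i. coeff h i \<noteq> 0} \<subseteq> {..<k}" using assms by (auto simp: not_le[symmetric] simp del: bit_not_zero_iff)
  then have "card {i. coeff h i \<noteq> 0} \<le> card {..<k}" by (intro card_mono) auto
  then show ?thesis by (simp add: L2_eq_card)
qed

lemma squarefree_nearby:
  fixes f :: "bit poly"
  assumes d: "0 < d" "2 * d + 1 \<le> degree f" "2 * degree f \<le> 2 ^ d"
  shows "\<exists>g. squarefree g \<and> degree g = degree f \<and> L2 (f - g) \<le> 2 * int d"
proof -
  obtain a b where f: "f = merge a b" using merge_surj by blast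
  define n where "n = degree f"
  have "f \<noteq> 0" using d by auto
  then have cn: "coeff f n = 1" unfolding n_def
    using leading_coeff_0_iff[of f] by (cases "lead_coeff f") auto
  have ca: "coeff a i = 0" if "n < 2 * i" for i
    using coeff_eq_0[of f "2 * i"] that by (simp add: f coeff_merge n_def)
  have cb: "coeff b i = 0" if "n < 2 * i + 1" for i
    using coeff_eq_0[of f "2 * i + 1"] that by (simp add: f coeff_merge n_def)
  have da: "2 * degree a \<le> n"
  proof (rule ccontr)
    assume *: "\<not> 2 * degree a \<le> n"
    then have "lead_coeff a = 0" by (intro ca) auto
    then have "a = 0" by (simp only: leading_coeff_0_iff)
    with * show False by simp
  qed
  have db: "2 * degree b \<le> n"
  proof (rule ccontr)
    assume *: "\<not> 2 * degree b \<le> n"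
    then have "lead_coeff b = 0" by (intro cb) auto
    then have "b = 0" by (simp only: leading_coeff_0_iff)
    with * show False by simp
  qed
  \<comment> \<open>The leading coefficient of \<open>f\<close> sits in \<open>a\<close> for even
    \<open>n\<close> and in \<open>b\<close> for odd \<open>n\<close>. That half has degree at least
    \<open>n div 2 \<ge> d\<close> and takes the first place in
    \<open>coprime_shift_exists\<close>.\<close>
  have "\<exists>u\<in>polys_below d. \<exists>v\<in>polys_below d.
           \<not> (\<exists>p. irreducible p \<and> p dvd a + u \<and> p dvd b + v)"
  proof (cases "even n")
    case True
    then have "n div 2 \<le> degree a" using cn by (intro le_degree) (auto simp: f coeff_merge)
    then show ?thesis using d da by (intro coprime_shift_exists) (auto simp: n_def)
  next
    case False
    then have "n div 2 \<le> degree b" using cn by (intro le_degree) (auto simp: f coeff_merge)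
    then have "\<exists>v\<in>polys_below d. \<exists>u\<in>polys_below d.
           \<not> (\<exists>p. irreducible p \<and> p dvd b + v \<and> p dvd a + u)"
      using d db by (intro coprime_shift_exists) (auto simp: n_def)
    then show ?thesis by blast
  qed
  then obtain u v where uv: "u \<in> polys_below d" "v \<in> polys_below d"
    and cop: "\<not> (\<exists>p. irreducible p \<and> p dvd a + u \<and> p dvd b + v)" by blast
  define g where "g = merge (a + u) (b + v)"
  have g: "g = f + merge u v" by (simp add: g_def f merge_add)
  \<comment> \<open>Only positions below \<open>2 * d\<close> change. Since
    \<open>2 * d < n\<close>, the degree survives.\<close>
  have low: "coeff (merge u v) i = 0" if "2 * d \<le> i" for i
    using uv that by (auto simp: coeff_merge polys_below_def)
  have "degree g = degree f"
  proof (rule antisym)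
    show "degree g \<le> degree f"
      using d low by (intro degree_le) (auto simp: g coeff_eq_0)
    show "degree f \<le> degree g"
      using d low cn by (intro le_degree) (auto simp: g n_def)
  qed
  moreover have "L2 (f - g) \<le> int (2 * d)"
    using low by (intro L2_le) (simp add: g)
  moreover have "squarefree g" unfolding g_def using cop by (rule squarefree_merge)
  ultimately show ?thesis by auto
qed

theorem theorem1p6:
  fixes \<epsilon> :: real
  assumes "\<epsilon> > 0"
  shows "\<exists>n0 :: nat. \<forall>n \<ge> n0. \<forall>f :: bit poly. degree f = n \<longrightarrow>
           (\<exists>g :: bit poly. squarefree g \<and> degree g = n \<and>
              real_of_int (L2 (f - g)) \<le> ln (real n) powr (2 * ln 2 + \<epsilon>))"
proof -
  \<comment> \<open>The exponent 6/5 lies strictly between 1, which absorbs the constant factors,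
    and 4/3, which \<open>ln2_ge_two_thirds\<close> puts below \<open>2 * ln 2\<close>. The last
    condition makes \<open>powr\<close> monotone in the exponent.\<close>
  have "eventually (\<lambda>n. 2 * (log 2 (real n) + 3) \<le> ln (real n) powr (6/5)) at_top"
    "eventually (\<lambda>n. 2 * (log 2 (real n) + 3) + 1 \<le> real n) at_top"
    "eventually (\<lambda>n. ln (real n) \<ge> 1) at_top"
    by real_asymp+
  then have "eventually (\<lambda>n. n > 0 \<and> 2 * (log 2 (real n) + 3) \<le> ln (real n) powr (6/5) \<and>
      2 * (log 2 (real n) + 3) + 1 \<le> real n \<and> ln (real n) \<ge> 1) at_top"
    using eventually_gt_at_top[of 0] by eventually_elim auto
  then obtain n0 where n0: "\<And>n. n \<ge> n0 \<Longrightarrow> n > 0 \<and> 2 * (log 2 (real n) + 3) \<le> ln (real n) powr (6/5) \<and>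
      2 * (log 2 (real n) + 3) + 1 \<le> real n \<and> ln (real n) \<ge> 1"
    by (auto simp: eventually_at_top_linorder)
  show ?thesis
  proof (intro exI[of _ n0] allI impI)
    fix n and f :: "bit poly" assume "n \<ge> n0" and f: "degree f = n"
    from n0[OF this(1)] have n: "n > 0" "ln (real n) \<ge> 1"
      "2 * (log 2 (real n) + 3) \<le> ln (real n) powr (6/5)"
      "2 * (log 2 (real n) + 3) + 1 \<le> real n" by auto
    \<comment> \<open>The summand 2 makes \<open>d\<close> positive and gives
      \<open>2^d \<ge> 4 * n\<close>, which covers the \<open>2 * n\<close> asked for by
      \<open>squarefree_nearby\<close>.\<close>
    define d where "d = nat \<lceil>log 2 (real n)\<rceil> + 2"
    have "log 2 (real n) \<ge> 0" using n(1) by simp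
    then have d: "log 2 (real n) + 2 \<le> real d" "real d \<le> log 2 (real n) + 3"
      unfolding d_def by linarith+
    have "4 * real n = 2 powr (log 2 (real n) + 2)" using n(1) by (simp add: powr_add)
    also have "\<dots> \<le> 2 powr real d" using d by simp
    finally have "real (4 * n) \<le> real (2 ^ d)" by (simp add: powr_realpow)
    then have "4 * n \<le> 2 ^ d" using of_nat_le_iff by blast
    moreover have "real (2 * d + 1) \<le> real n" using n(4) d by simp
    then have "2 * d + 1 \<le> n" using of_nat_le_iff by blast
    ultimately obtain g where g: "squarefree g" "degree g = n" "L2 (f - g) \<le> 2 * int d"
      using squarefree_nearby[of d f] f by (auto simp: d_def)
    have "real_of_int (L2 (f - g)) \<le> 2 * real d" using g(3) by linarith
    also have "\<dots> \<le> ln (real n) powr (6/5)" using n(3) d by simp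
    also have "\<dots> \<le> ln (real n) powr (2 * ln 2 + \<epsilon>)"
      using n(2) ln2_ge_two_thirds assms by (intro powr_mono) auto
    finally show "\<exists>g. squarefree g \<and> degree g = n \<and>
        real_of_int (L2 (f - g)) \<le> ln (real n) powr (2 * ln 2 + \<epsilon>)"
      using g by blast
  qed
qed

end
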